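(* Let $S$ be a Garside family in a left-cancellative category $\mathcal{C}$ and let $W$ be a $\square$-witness for $S^\sharp$. Then the algorithm Normal Decomposition described in the context, running on an $S^\sharp$-decomposition $b_1|\cdots|b_p$ of an element $g$ of $\mathcal{C}$ (all $b_i\in S^\sharp$, $b_1\cdots b_p=g$), returns an $S$-normal decomposition of $g$. The map $W$ is called $p(p-1)/2$ times.
   Context: Categories are viewed as monoids with a partial product: $fg$ is defined iff the target of $f$ is the source of $g$. $\mathcal{C}$ is left-cancellative if $fg=fg'$ implies $g=g'$. $f\preccurlyeq g$ means $fg'=g$ for some $g'\in\mathcal{C}$. $\mathcal{C}^\times$ is the family of invertible elements, and $S^\sharp=S\mathcal{C}^\times\cup\mathcal{C}^\times$ for $S\subseteq\mathcal{C}$. A path $g_1|\cdots|g_p$ is a finite sequence of elements of $\mathcal{C}$ with consecutive entries composable; it is a decomposition of $g$ if $g_1\cdots g_p=g$. It is $S$-greedy if, for every $i<p$, all $a\in S$ and $f\in\mathcal{C}$, $a\preccurlyeq fg_ig_{i+1}$ implies $a\preccurlyeq fg_i$; it is $S$-normal if it is $S$-greedy and every entry lies in $S^\sharp$. $S$ is a Garside family if every element of $\mathcal{C}$ admits an $S$-normal decomposition. A $\square$-witness on $A\subseteq\mathcal{C}$ is a map $W$ that assigns to every composable pair $(a_1,a_2)$ of elements of $A$ a pair $(b_1,b_2)$ of elements of $A$ such that $b_1b_2=a_1a_2$ and $b_1|b_2$ is $A$-greedy. Algorithm Normal Decomposition on input $b_1|\cdots|b_p$: put $b_{0,i}:=b_i$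 for $1\le i\le p$. For $j$ decreasing from $p$ to $1$: for $i$ increasing from $1$ to $p-j$ (if any) put $(a_{i,j-1},b_{i,j}):=W(b_{i-1,j},a_{i,j})$; then put $a_{p-j+1,j-1}:=b_{p-j,j}$. Return $a_{1,0}|\cdots|a_{p,0}$. *)

theory Defs
  imports Main
begin

section \<open>Categories as partial monoids\<close>

text \<open>The elements of the category are its morphisms. Products are written in diagrammatic order:
  \<open>f \<cdot> g\<close> is defined iff the target of \<open>f\<close> is the source of \<open>g\<close>. As HOL functions are total, the value
  of \<open>f \<cdot> g\<close> is unspecified otherwise, and composability is always required explicitly.\<close>

record ('o, 'm) cat =
  Obj :: "'o set"
  Elt :: "'m set"
  src :: "'m \<Rightarrow> 'o" ("src\<index>")
  tgt :: "'m \<Rightarrow> 'o" ("tgt\<index>")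
  ident :: "'o \<Rightarrow> 'm" ("ident\<index>")
  mult :: "'m \<Rightarrow> 'm \<Rightarrow> 'm" (infixl "\<cdot>\<index>" 70)

locale category =
  fixes C :: "('o, 'm) cat" (structure)
  assumes src_closed: "f \<in> Elt C \<Longrightarrow> src f \<in> Obj C"
    and tgt_closed: "f \<in> Elt C \<Longrightarrow> tgt f \<in> Obj C"
    and ident_closed: "x \<in> Obj C \<Longrightarrow> ident x \<in> Elt C"
    and src_ident: "x \<in> Obj C \<Longrightarrow> src (ident x) = x"
    and tgt_ident: "x \<in> Obj C \<Longrightarrow> tgt (ident x) = x"
    and mult_closed: "\<lbrakk>f \<in> Elt C; g \<in> Elt C; tgt f = src g\<rbrakk> \<Longrightarrow> f \<cdot> g \<in> Elt C"
    and src_mult: "\<lbrakk>f \<in> Elt C; g \<in> Elt C; tgt f = src g\<rbrakk> \<Longrightarrow> src (f \<cdot> g) = src f"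
    and tgt_mult: "\<lbrakk>f \<in> Elt C; g \<in> Elt C; tgt f = src g\<rbrakk> \<Longrightarrow> tgt (f \<cdot> g) = tgt g"
    and ident_left: "f \<in> Elt C \<Longrightarrow> ident (src f) \<cdot> f = f"
    and ident_right: "f \<in> Elt C \<Longrightarrow> f \<cdot> ident (tgt f) = f"
    and mult_assoc: "\<lbrakk>f \<in> Elt C; g \<in> Elt C; h \<in> Elt C; tgt f = src g; tgt g = src h\<rbrakk>
      \<Longrightarrow> (f \<cdot> g) \<cdot> h = f \<cdot> (g \<cdot> h)"

locale left_cancellative_category = category +
  assumes left_cancel:
    "\<lbrakk>f \<in> Elt C; g \<in> Elt C; g' \<in> Elt C; tgt f = src g; tgt f = src g'; f \<cdot> g = f \<cdot> g'\<rbrakk> \<Longrightarrow> g = g'"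

definition left_divides :: "('o, 'm) cat \<Rightarrow> 'm \<Rightarrow> 'm \<Rightarrow> bool" (infix "\<preceq>\<index>" 50) where
  "left_divides C f g \<longleftrightarrow> (\<exists>g' \<in> Elt C. tgt\<^bsub>C\<^esub> f = src\<^bsub>C\<^esub> g' \<and> f \<cdot>\<^bsub>C\<^esub> g' = g)"

definition invertibles :: "('o, 'm) cat \<Rightarrow> 'm set" where
  "invertibles C = {f \<in> Elt C. \<exists>g \<in> Elt C. tgt\<^bsub>C\<^esub> f = src\<^bsub>C\<^esub> g \<and> tgt\<^bsub>C\<^esub> g = src\<^bsub>C\<^esub> f \<and>
     f \<cdot>\<^bsub>C\<^esub> g = ident\<^bsub>C\<^esub> (src\<^bsub>C\<^esub> f) \<and> g \<cdot>\<^bsub>C\<^esub> f = ident\<^bsub>C\<^esub> (tgt\<^bsub>C\<^esub> f)}"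

definition sharp :: "('o, 'm) cat \<Rightarrow> 'm set \<Rightarrow> 'm set" where
  "sharp C S = {s \<cdot>\<^bsub>C\<^esub> e | s e. s \<in> S \<and> e \<in> invertibles C \<and> tgt\<^bsub>C\<^esub> s = src\<^bsub>C\<^esub> e} \<union> invertibles C"


section \<open>Paths and normal decompositions\<close>

definition path :: "('o, 'm) cat \<Rightarrow> 'm list \<Rightarrow> bool" where
  "path C gs \<longleftrightarrow> set gs \<subseteq> Elt C \<and>
     (\<forall>i. Suc i < length gs \<longrightarrow> tgt\<^bsub>C\<^esub> (gs ! i) = src\<^bsub>C\<^esub> (gs ! Suc i))"

fun path_prod :: "('o, 'm) cat \<Rightarrow> 'm list \<Rightarrow> 'm" where
  "path_prod C [] = undefined"
| "path_prod C [g] = g"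
| "path_prod C (g # h # gs) = g \<cdot>\<^bsub>C\<^esub> path_prod C (h # gs)"

text \<open>The empty path is a decomposition of every identity element (there is one empty product for
  each object), hence the case distinction.\<close>

definition decomposition :: "('o, 'm) cat \<Rightarrow> 'm list \<Rightarrow> 'm \<Rightarrow> bool" where
  "decomposition C gs g \<longleftrightarrow> path C gs \<and>
     (if gs = [] then g \<in> ident\<^bsub>C\<^esub> ` Obj C else path_prod C gs = g)"

definition greedy :: "('o, 'm) cat \<Rightarrow> 'm set \<Rightarrow> 'm list \<Rightarrow> bool" where
  "greedy C S gs \<longleftrightarrow> path C gs \<and>
     (\<forall>i. Suc i < length gs \<longrightarrow>
       (\<forall>a \<in> S. \<forall>f \<in> Elt C. tgt\<^bsub>C\<^esub> f = src\<^bsub>C\<^esub> (gs ! i) \<longrightarrow>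
          a \<preceq>\<^bsub>C\<^esub> f \<cdot>\<^bsub>C\<^esub> gs ! i \<cdot>\<^bsub>C\<^esub> gs ! Suc i \<longrightarrow> a \<preceq>\<^bsub>C\<^esub> f \<cdot>\<^bsub>C\<^esub> gs ! i))"

definition normal :: "('o, 'm) cat \<Rightarrow> 'm set \<Rightarrow> 'm list \<Rightarrow> bool" where
  "normal C S gs \<longleftrightarrow> greedy C S gs \<and> set gs \<subseteq> sharp C S"

definition normal_decomposition :: "('o, 'm) cat \<Rightarrow> 'm set \<Rightarrow> 'm list \<Rightarrow> 'm \<Rightarrow> bool" where
  "normal_decomposition C S gs g \<longleftrightarrow> decomposition C gs g \<and> normal C S gs"

definition garside_family :: "('o, 'm) cat \<Rightarrow> 'm set \<Rightarrow> bool" where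
  "garside_family C S \<longleftrightarrow> S \<subseteq> Elt C \<and> (\<forall>g \<in> Elt C. \<exists>gs. normal_decomposition C S gs g)"


section \<open>Square witnesses\<close>

text \<open>A witness is a partial map whose domain is exactly the set of composable pairs of
  elements of \<open>A\<close>.\<close>

definition square_witness ::
    "('o, 'm) cat \<Rightarrow> 'm set \<Rightarrow> ('m \<times> 'm \<Rightarrow> ('m \<times> 'm) option) \<Rightarrow> bool" where
  "square_witness C A W \<longleftrightarrow> A \<subseteq> Elt C \<and>
     dom W = {(a1, a2). a1 \<in> A \<and> a2 \<in> A \<and> tgt\<^bsub>C\<^esub> a1 = src\<^bsub>C\<^esub> a2} \<and>
     (\<forall>a1 a2 b1 b2. W (a1, a2) = Some (b1, b2) \<longrightarrow>
        b1 \<in> A \<and> b2 \<in> A \<and> b1 \<cdot>\<^bsub>C\<^esub> b2 = a1 \<cdot>\<^bsub>C\<^esub> a2 \<and> greedy C A [b1, b2])"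


section \<open>The algorithm\<close>

text \<open>The state holds the two doubly indexed families \<open>a\<^bsub>i,j\<^esub>\<close> and \<open>b\<^bsub>i,j\<^esub>\<close> and the number of calls to
  \<open>W\<close> made so far. The run aborts with \<^const>\<open>None\<close> as soon as \<open>W\<close> is called outside its domain.\<close>

record 'm nd_state =
  fam_a :: "nat \<Rightarrow> nat \<Rightarrow> 'm"
  fam_b :: "nat \<Rightarrow> nat \<Rightarrow> 'm"
  calls :: nat

definition set2 :: "nat \<Rightarrow> nat \<Rightarrow> 'm \<Rightarrow> (nat \<Rightarrow> nat \<Rightarrow> 'm) \<Rightarrow> nat \<Rightarrow> nat \<Rightarrow> 'm" where
  "set2 i j x u = u(i := (u i)(j := x))"

primrec for_loop :: "'i list \<Rightarrow> ('i \<Rightarrow> 's \<Rightarrow> 's option) \<Rightarrow> 's \<Rightarrow> 's option" where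
  "for_loop [] body s = Some s"
| "for_loop (i # is) body s = Option.bind (body i s) (for_loop is body)"

definition nd_step ::
    "('m \<times> 'm \<Rightarrow> ('m \<times> 'm) option) \<Rightarrow> nat \<Rightarrow> nat \<Rightarrow> 'm nd_state \<Rightarrow> 'm nd_state option" where
  "nd_step W j i s = map_option
     (\<lambda>(x, y). s\<lparr>fam_a := set2 i (j - 1) x (fam_a s), fam_b := set2 i j y (fam_b s),
                 calls := Suc (calls s)\<rparr>)
     (W (fam_b s (i - 1) j, fam_a s i j))"

definition nd_round ::
    "('m \<times> 'm \<Rightarrow> ('m \<times> 'm) option) \<Rightarrow> nat \<Rightarrow> nat \<Rightarrow> 'm nd_state \<Rightarrow> 'm nd_state option" where
  "nd_round W p j s = map_option
     (\<lambda>s'. s'\<lparr>fam_a := set2 (p - j + 1) (j - 1) (fam_b s' (p - j) j) (fam_a s')\<rparr>)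
     (for_loop [1..<Suc (p - j)] (nd_step W j) s)"

text \<open>Only the entries \<open>b\<^bsub>0,i\<^esub>\<close> with \<open>1 \<le> i \<le> p\<close> are meaningful in the initial state.\<close>

definition nd_init :: "'m list \<Rightarrow> 'm nd_state" where
  "nd_init bs = \<lparr>fam_a = (\<lambda>i j. undefined),
                 fam_b = (\<lambda>i j. if i = 0 then bs ! (j - 1) else undefined),
                 calls = 0\<rparr>"

text \<open>The result is the returned path together with the number of calls to \<open>W\<close>.\<close>

definition run_normal_decomposition ::
    "('m \<times> 'm \<Rightarrow> ('m \<times> 'm) option) \<Rightarrow> 'm list \<Rightarrow> ('m list \<times> nat) option" where
  "run_normal_decomposition W bs = (let p = length bs in map_option
     (\<lambda>s. (map (\<lambda>i. fam_a s i 0) [1..<Suc p], calls s))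
     (for_loop (rev [1..<Suc p]) (nd_round W p) (nd_init bs)))"

end

theory Submission
  imports Defs
begin

text \<open>The outer loop inserts the letters of the input one at a time, from right to left: the round
  with index \<open>j\<close> turns a normal path \<open>a\<^sub>1|\<dots>|a\<^sub>n\<close> into a normal path for \<open>b\<^sub>0 a\<^sub>1 \<cdots> a\<^sub>n\<close>, where \<open>b\<^sub>0\<close> is
  the \<open>j\<close>-th letter. It does so by pushing \<open>b\<^sub>0\<close> through the path: each call of \<open>W\<close> replaces
  \<open>b\<^sub>i\<^sub>-\<^sub>1 a\<^sub>i\<close> by an equal product \<open>a'\<^sub>i b\<^sub>i\<close>, and the path \<open>a'\<^sub>1|\<dots>|a'\<^sub>n|b\<^sub>n\<close> is the outcome. The
  calls form a row of commutative squares, so the product is preserved; what has to be seen is that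
  the outcome is greedy. Its last pair is greedy because it is a value of \<open>W\<close>. Every other pair is
  greedy by the domino rule \<open>greedy_domino\<close>: an \<open>a \<in> S\<^sup>\<sharp>\<close> that divides \<open>f a'\<^sub>1 a'\<^sub>2\<close> divides
  \<open>f a'\<^sub>1 a'\<^sub>2 b\<^sub>2 = f b\<^sub>0 a\<^sub>1 a\<^sub>2\<close>, hence \<open>f b\<^sub>0 a\<^sub>1 = f a'\<^sub>1 b\<^sub>1\<close> as \<open>a\<^sub>1|a\<^sub>2\<close> is greedy, hence \<open>f a'\<^sub>1\<close> as
  \<open>a'\<^sub>1|b\<^sub>1\<close> is greedy.

  Greediness is meant with respect to \<open>S\<^sup>\<sharp>\<close> throughout, which is what \<open>W\<close> provides; it implies
  \<open>S\<close>-greediness because \<open>S \<subseteq> S\<^sup>\<sharp>\<close>. The round with index \<open>j\<close> makes \<open>p - j\<close> calls, so there are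
  \<open>0 + 1 + \<dots> + (p - 1) = p (p - 1) / 2\<close> in total.

  The argument about paths is carried out for an inductive relation \<open>pushes\<close> on lists, whose
  recursion is that of the inner loop; \<open>for_loop_pushes\<close> transfers it to the loop state.\<close>


section \<open>Paths and products\<close>

lemma path_Nil [simp]: "path C []"
  by (simp add: path_def)

lemma path_single [simp]: "path C [x] \<longleftrightarrow> x \<in> Elt C"
  by (simp add: path_def)

lemma path_Cons_Cons [simp]:
  "path C (x # y # zs) \<longleftrightarrow> x \<in> Elt C \<and> tgt\<^bsub>C\<^esub> x = src\<^bsub>C\<^esub> y \<and> path C (y # zs)"
  unfolding path_def by (auto simp: nth_Cons split: nat.splits)

lemma path_Cons: "path C (x # ys) \<longleftrightarrow> x \<in> Elt C \<and> (ys \<noteq> [] \<longrightarrow> tgt\<^bsub>C\<^esub> x = src\<^bsub>C\<^esub> (hd ys)) \<and> path C ys"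
  by (cases ys) auto

lemma path_prod_Cons: "ys \<noteq> [] \<Longrightarrow> path_prod C (x # ys) = x \<cdot>\<^bsub>C\<^esub> path_prod C ys"
  by (cases ys) auto

lemma (in category) path_prod_Elt_src:
  assumes "path C gs" and "gs \<noteq> []"
  shows "path_prod C gs \<in> Elt C \<and> src (path_prod C gs) = src (hd gs)"
  using assms
proof (induction gs)
  case (Cons g gs)
  show ?case
  proof (cases "gs = []")
    case False
    with Cons show ?thesis
      by (auto simp: path_Cons path_prod_Cons mult_closed src_mult)
  qed (use Cons in auto)
qed simp


section \<open>Greedy paths\<close>

lemma greedy_imp_path: "greedy C S gs \<Longrightarrow> path C gs"
  by (simp add: greedy_def)

lemma greedy_Nil [simp]: "greedy C S []"
  by (simp add: greedy_def)

lemma greedy_single [simp]: "greedy C S [x] \<longleftrightarrow> x \<in> Elt C"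
  by (simp add: greedy_def)

lemma greedy_Cons_Cons:
  "greedy C S (x # y # zs) \<longleftrightarrow> greedy C S [x, y] \<and> greedy C S (y # zs)"
proof -
  have split: "(\<forall>i. Suc i < length (x # y # zs) \<longrightarrow> P i) \<longleftrightarrow>
      P 0 \<and> (\<forall>i. Suc i < length (y # zs) \<longrightarrow> P (Suc i))" for P :: "nat \<Rightarrow> bool"
    by (metis Suc_less_eq length_Cons not0_implies_Suc zero_less_Suc)
  have "path C (x # y # zs) \<longleftrightarrow> path C [x, y] \<and> path C (y # zs)"
    by (auto simp: path_def[of C "y # zs"])
  then show ?thesis
    unfolding greedy_def split by auto
qed

lemma greedy_ConsD: "greedy C S (x # ys) \<Longrightarrow> greedy C S ys"
  by (cases ys) (simp, metis greedy_Cons_Cons)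

lemma greedy_pairD:
  assumes "greedy C S [x, y]" and "a \<in> S" and "f \<in> Elt C" and "tgt\<^bsub>C\<^esub> f = src\<^bsub>C\<^esub> x"
    and "a \<preceq>\<^bsub>C\<^esub> f \<cdot>\<^bsub>C\<^esub> x \<cdot>\<^bsub>C\<^esub> y"
  shows "a \<preceq>\<^bsub>C\<^esub> f \<cdot>\<^bsub>C\<^esub> x"
  using assms by (simp add: greedy_def)

lemma greedy_antimono: "S \<subseteq> T \<Longrightarrow> greedy C T gs \<Longrightarrow> greedy C S gs"
  unfolding greedy_def by blast

lemma (in category) left_divides_mult_right:
  assumes "a \<preceq> h" and "a \<in> Elt C" and "k \<in> Elt C" and "tgt h = src k"
  shows "a \<preceq> h \<cdot> k"
  using assms unfolding left_divides_def by (metis mult_assoc mult_closed src_mult tgt_mult)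

text \<open>The domino rule: two adjacent commutative squares with top row \<open>a\<^sub>1|a\<^sub>2\<close>, bottom row
  \<open>a'\<^sub>1|a'\<^sub>2\<close> and vertical arrows \<open>b\<^sub>0\<close>, \<open>b\<^sub>1\<close>, \<open>b\<^sub>2\<close>. A divisor of \<open>f a'\<^sub>1 a'\<^sub>2\<close> is followed around
  the diagram to \<open>f b\<^sub>0 a\<^sub>1 a\<^sub>2\<close>, and then cut down twice.\<close>

lemma (in category) greedy_domino:
  assumes "A \<subseteq> Elt C"
    and top: "greedy C A [a1, a2]" and left: "greedy C A [a1', b1]" and right: "path C [a2', b2]"
    and b0: "b0 \<in> Elt C" "tgt b0 = src a1" and b1: "tgt b1 = src a2"
    and sq1: "b0 \<cdot> a1 = a1' \<cdot> b1" and sq2: "b1 \<cdot> a2 = a2' \<cdot> b2"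
  shows "greedy C A [a1', a2']"
proof -
  have path: "path C [a1, a2]" "path C [a1', b1]"
    using top left by (blast dest: greedy_imp_path)+
  note elts = path[simplified] right[simplified] b0 b1
  have src_a2': "src a2' = src b1"
    using elts sq2 by (metis src_mult)
  have src_b0: "src b0 = src a1'"
    using elts sq1 by (metis src_mult)
  have "a \<preceq> f \<cdot> a1'"
    if a: "a \<in> A" and f: "f \<in> Elt C" "tgt f = src a1'" and div: "a \<preceq> f \<cdot> a1' \<cdot> a2'" for a f
  proof -
    have "a \<preceq> f \<cdot> a1' \<cdot> a2' \<cdot> b2"
      by (rule left_divides_mult_right[OF div])
        (use a assms(1) f elts src_a2' in \<open>auto simp: mult_closed tgt_mult\<close>)
    also have "f \<cdot> a1' \<cdot> a2' \<cdot> b2 = f \<cdot> a1' \<cdot> (a2' \<cdot> b2)"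
      using f elts src_a2' by (simp add: mult_assoc mult_closed tgt_mult src_mult)
    also have "\<dots> = f \<cdot> (a1' \<cdot> b1) \<cdot> a2"
      using f elts by (simp flip: sq2 add: mult_assoc mult_closed tgt_mult src_mult)
    also have "\<dots> = (f \<cdot> b0) \<cdot> a1 \<cdot> a2"
      using f elts src_b0 by (simp flip: sq1 add: mult_assoc mult_closed tgt_mult src_mult)
    finally have "a \<preceq> (f \<cdot> b0) \<cdot> a1"
      using f elts src_b0 by (intro greedy_pairD[OF top a]) (auto simp: mult_closed tgt_mult)
    also have "(f \<cdot> b0) \<cdot> a1 = f \<cdot> a1' \<cdot> b1"
      using f elts src_b0 by (simp add: mult_assoc sq1)
    finally show ?thesis
      using greedy_pairD[OF left a f] by blast
  qed
  then show ?thesis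
    using elts src_a2' by (simp add: greedy_def)
qed


section \<open>Pushing an element through a path\<close>

inductive pushes :: "('m \<times> 'm \<Rightarrow> ('m \<times> 'm) option) \<Rightarrow> 'm \<Rightarrow> 'm list \<Rightarrow> 'm list \<Rightarrow> bool"
  for W where
  pushes_Nil: "pushes W b [] [b]"
| pushes_Cons: "\<lbrakk>W (b, a) = Some (x, y); pushes W y as cs\<rbrakk> \<Longrightarrow> pushes W b (a # as) (x # cs)"

inductive_cases pushes_NilE: "pushes W b [] cs"
inductive_cases pushes_ConsE: "pushes W b (a # as) cs"

lemma pushes_length: "pushes W b as cs \<Longrightarrow> length cs = Suc (length as)"
  by (induction rule: pushes.induct) auto

lemma (in category) square_witness_apply:
  assumes W: "square_witness C A W" and "b \<in> A" "a \<in> A" "tgt b = src a"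
  obtains x y where "W (b, a) = Some (x, y)" "x \<in> A" "y \<in> A" "x \<cdot> y = b \<cdot> a"
    "greedy C A [x, y]" "src x = src b" "tgt y = tgt a"
proof -
  have A: "A \<subseteq> Elt C" and "(b, a) \<in> dom W"
    using assms unfolding square_witness_def by auto
  then obtain x y where xy: "W (b, a) = Some (x, y)"
    by auto
  then have *: "x \<in> A" "y \<in> A" "x \<cdot> y = b \<cdot> a" "greedy C A [x, y]"
    using W unfolding square_witness_def by blast+
  have "tgt x = src y"
    using greedy_imp_path[OF *(4)] by simp
  then have "src x = src b" "tgt y = tgt a"
    using * A assms(2-4) by (metis src_mult subsetD, metis tgt_mult subsetD)
  with xy * show thesis
    by (rule that)
qed

text \<open>The condition on the source of the first entry makes the outcome composable with the letter
  that the next round pushes through it.\<close>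

lemma (in category) pushes_greedy:
  assumes W: "square_witness C A W"
  shows "\<lbrakk>path C (b # as); set (b # as) \<subseteq> A; greedy C A as\<rbrakk> \<Longrightarrow>
    \<exists>cs. pushes W b as cs \<and> set cs \<subseteq> A \<and> greedy C A cs \<and> src (hd cs) = src b \<and>
      path_prod C cs = path_prod C (b # as)"
proof (induction as arbitrary: b)
  case Nil
  then show ?case
    by (intro exI[of _ "[b]"]) (auto intro: pushes_Nil)
next
  case (Cons a as)
  have A: "A \<subseteq> Elt C"
    using W by (simp add: square_witness_def)
  have b: "b \<in> A" "a \<in> A" "tgt b = src a" and as: "path C (a # as)"
    using Cons.prems by auto
  obtain x y where xy: "W (b, a) = Some (x, y)" "x \<in> A" "y \<in> A" "x \<cdot> y = b \<cdot> a"
    "greedy C A [x, y]" "src x = src b" "tgt y = tgt a"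
    by (rule square_witness_apply[OF W b])
  have y: "tgt x = src y"
    using greedy_imp_path[OF xy(5)] by simp
  have "path C (y # as)"
    using as xy(3,7) A by (auto simp: path_Cons)
  moreover have "set (y # as) \<subseteq> A"
    using Cons.prems xy by auto
  ultimately obtain cs where cs: "pushes W y as cs" "set cs \<subseteq> A" "greedy C A cs"
    "src (hd cs) = src y" "path_prod C cs = path_prod C (y # as)"
    using Cons.IH greedy_ConsD[OF Cons.prems(3)] by blast
  have "cs \<noteq> []"
    using pushes_length[OF cs(1)] by auto
  have "greedy C A (x # cs)"
  proof (cases as)
    case Nil
    with cs(1) xy(5) show ?thesis
      by (auto elim: pushes_NilE)
  next
    case (Cons a2 as')
    then obtain x2 y2 cs' where cs': "cs = x2 # cs'" "W (y, a2) = Some (x2, y2)"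
      using cs(1) by (auto elim: pushes_ConsE)
    have a2: "tgt y = src a2" "a2 \<in> A"
      using \<open>path C (y # as)\<close> \<open>set (y # as) \<subseteq> A\<close> Cons by auto
    have "x2 \<cdot> y2 = y \<cdot> a2" "path C [x2, y2]"
      using cs'(2) xy(3) a2 square_witness_apply[OF W] greedy_imp_path
      by (metis option.inject prod.inject)+
    moreover have "greedy C A [a, a2]"
      using Cons.prems(3) Cons by (metis greedy_Cons_Cons)
    ultimately have "greedy C A [x, x2]"
      using greedy_domino[OF A _ xy(5), of a a2 x2 y2 b] A b xy(4) a2 by auto
    then show ?thesis
      using cs(3) cs'(1) by (metis greedy_Cons_Cons)
  qed
  moreover have "path_prod C (x # cs) = path_prod C (b # a # as)"
  proof (cases "as = []")
    case True
    then show ?thesis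
      using cs(5) \<open>cs \<noteq> []\<close> xy(4) by (simp add: path_prod_Cons)
  next
    case False
    then have P: "path_prod C as \<in> Elt C" "src (path_prod C as) = tgt a"
      using path_prod_Elt_src[of as] as by (auto simp: path_Cons)
    have elts: "x \<in> Elt C" "y \<in> Elt C" "b \<in> Elt C" "a \<in> Elt C"
      using xy(2,3) b(1,2) A by auto
    have "path_prod C (x # cs) = x \<cdot> (y \<cdot> path_prod C as)"
      using cs(5) \<open>cs \<noteq> []\<close> False by (simp add: path_prod_Cons)
    also have "\<dots> = (x \<cdot> y) \<cdot> path_prod C as"
      using elts P y xy(7) by (simp add: mult_assoc)
    also have "\<dots> = b \<cdot> (a \<cdot> path_prod C as)"
      using elts P b(3) by (simp add: xy(4) mult_assoc)
    finally show ?thesis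
      using False by (simp add: path_prod_Cons)
  qed
  ultimately show ?case
    using cs(1,2) xy(1,2,6) by (intro exI[of _ "x # cs"]) (auto intro: pushes_Cons)
qed


section \<open>The loops\<close>

text \<open>The hypothesis \<open>1 \<le> j\<close> makes \<open>j - 1\<close> differ from \<open>j\<close>, so that the entries \<open>a\<^bsub>i,j-1\<^esub>\<close> written by
  the loop do not interfere with the entries \<open>a\<^bsub>i,j\<^esub>\<close> still to be read. That the entries with first
  index below \<open>i\<close> are left alone is needed to keep the first entry of the outcome through the rest of
  the loop.\<close>

lemma for_loop_pushes:
  assumes "pushes W b as cs" and "1 \<le> i" "i \<le> n" "1 \<le> j"
    and "fam_b s (i - 1) j = b" and "map (\<lambda>k. fam_a s k j) [i..<n] = as"
  shows "\<exists>s'. for_loop [i..<n] (nd_step W j) s = Some s' \<and>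
    map (\<lambda>k. fam_a s' k (j - 1)) [i..<n] @ [fam_b s' (n - 1) j] = cs \<and>
    (\<forall>k<i. fam_a s' k = fam_a s k) \<and> fam_b s' 0 = fam_b s 0 \<and> calls s' = calls s + (n - i)"
  using assms
proof (induction arbitrary: i s rule: pushes.induct)
  case (pushes_Nil b)
  then have "i = n"
    by simp
  with pushes_Nil show ?case
    by simp
next
  case (pushes_Cons b a x y as cs)
  then have "i < n"
    using upt_conv_Nil[of n i] by (cases "i < n") auto
  then have upt: "[i..<n] = i # [Suc i..<n]"
    by (rule upt_conv_Cons)
  define t where "t = s\<lparr>fam_a := set2 i (j - 1) x (fam_a s), fam_b := set2 i j y (fam_b s),
                        calls := Suc (calls s)\<rparr>"
  have step: "nd_step W j i s = Some t"
    using pushes_Cons.hyps(1) pushes_Cons.prems(4,5) by (simp add: nd_step_def t_def upt)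
  have "map (\<lambda>k. fam_a t k j) [Suc i..<n] = as"
    using pushes_Cons.prems(3,5) by (auto simp: upt t_def set2_def)
  then obtain s' where s': "for_loop [Suc i..<n] (nd_step W j) t = Some s'"
    "map (\<lambda>k. fam_a s' k (j - 1)) [Suc i..<n] @ [fam_b s' (n - 1) j] = cs"
    "\<forall>k<Suc i. fam_a s' k = fam_a t k" "fam_b s' 0 = fam_b t 0"
    "calls s' = calls t + (n - Suc i)"
    using pushes_Cons.IH[of "Suc i" t] pushes_Cons.prems(3) \<open>i < n\<close>
    by (auto simp: t_def set2_def)
  show ?case
    using s' step \<open>i < n\<close> pushes_Cons.prems(1)
    by (intro exI[of _ s']) (auto simp: upt t_def set2_def)
qed

definition nd_path :: "nat \<Rightarrow> nat \<Rightarrow> 'm nd_state \<Rightarrow> 'm list" where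
  "nd_path p j s = map (\<lambda>i. fam_a s i j) [1..<Suc (p - j)]"

lemma nd_round_pushes:
  assumes "pushes W (fam_b s 0 j) (nd_path p j s) cs" and "1 \<le> j" "j \<le> p"
  shows "\<exists>s'. nd_round W p j s = Some s' \<and> nd_path p (j - 1) s' = cs \<and>
    fam_b s' 0 = fam_b s 0 \<and> calls s' = calls s + (p - j)"
proof -
  obtain t where t: "for_loop [1..<Suc (p - j)] (nd_step W j) s = Some t"
    "map (\<lambda>k. fam_a t k (j - 1)) [1..<Suc (p - j)] @ [fam_b t (p - j) j] = cs"
    "fam_b t 0 = fam_b s 0" "calls t = calls s + (p - j)"
    using for_loop_pushes[OF assms(1), of 1 "Suc (p - j)" j s] assms(2)
    by (auto simp: nd_path_def)
  define s' where "s' = t\<lparr>fam_a := set2 (p - j + 1) (j - 1) (fam_b t (p - j) j) (fam_a t)\<rparr>"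
  have "[1..<Suc (p - (j - 1))] = [1..<Suc (p - j)] @ [Suc (p - j)]"
    using assms(2,3) by (simp add: Suc_diff_le flip: Suc_diff_eq_diff_pred)
  then have "nd_path p (j - 1) s' = cs"
    using t(2) by (auto simp: nd_path_def s'_def set2_def)
  then show ?thesis
    using t by (auto simp: nd_round_def s'_def)
qed

text \<open>The decomposition of the last \<open>p - j\<close> letters is stated with products and not with
  \<^const>\<open>decomposition\<close>, since the empty suffix, from which the algorithm starts, has no product.
  The letter \<open>b\<^bsub>k+1\<^esub>\<close> of the input is the list entry \<open>bs ! k\<close>, so \<open>bs ! j\<close> is the letter inserted last.\<close>

definition nd_inv :: "('o, 'm) cat \<Rightarrow> 'm set \<Rightarrow> 'm list \<Rightarrow> nat \<Rightarrow> 'm nd_state \<Rightarrow> bool" where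
  "nd_inv C A bs j s \<longleftrightarrow>
     set (nd_path (length bs) j s) \<subseteq> A \<and> greedy C A (nd_path (length bs) j s) \<and>
     (j < length bs \<longrightarrow> src\<^bsub>C\<^esub> (hd (nd_path (length bs) j s)) = src\<^bsub>C\<^esub> (bs ! j) \<and>
        path_prod C (nd_path (length bs) j s) = path_prod C (drop j bs)) \<and>
     (\<forall>k<length bs. fam_b s 0 (Suc k) = bs ! k) \<and>
     2 * calls s = (length bs - j) * (length bs - j - 1)"

lemma nd_inv_init: "nd_inv C A bs (length bs) (nd_init bs)"
  by (simp add: nd_inv_def nd_path_def nd_init_def)

lemma (in category) nd_inv_round:
  assumes W: "square_witness C A W" and bs: "path C bs" "set bs \<subseteq> A"
    and j: "j < length bs" and inv: "nd_inv C A bs (Suc j) s"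
  shows "\<exists>s'. nd_round W (length bs) (Suc j) s = Some s' \<and> nd_inv C A bs j s'"
proof -
  let ?p = "length bs" and ?as = "nd_path (length bs) (Suc j) s"
  have b: "fam_b s 0 (Suc j) = bs ! j" "bs ! j \<in> A"
    using inv j bs(2) nth_mem by (auto simp: nd_inv_def)
  have empty: "?as = [] \<longleftrightarrow> ?p = Suc j"
    using j by (auto simp: nd_path_def)
  have "path C (bs ! j # ?as)"
    using inv empty bs(1) j by (auto simp: path_Cons nd_inv_def greedy_imp_path)
      (auto simp: path_def)
  then obtain cs where cs: "pushes W (bs ! j) ?as cs" "set cs \<subseteq> A" "greedy C A cs"
    "src (hd cs) = src (bs ! j)" "path_prod C cs = path_prod C (bs ! j # ?as)"
    using pushes_greedy[OF W, of "bs ! j" ?as] inv b(2) by (auto simp: nd_inv_def)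
  obtain s' where s': "nd_round W ?p (Suc j) s = Some s'" "nd_path ?p j s' = cs"
    "fam_b s' 0 = fam_b s 0" "calls s' = calls s + (?p - Suc j)"
    using nd_round_pushes[of W s "Suc j" ?p cs] cs(1) b(1) j by auto
  have "path_prod C cs = path_prod C (drop j bs)"
    using cs(5) inv empty j
    by (cases "?p = Suc j") (auto simp: nd_inv_def path_prod_Cons simp flip: Cons_nth_drop_Suc)
  moreover have "2 * calls s' = (?p - j) * (?p - j - 1)"
  proof -
    obtain d where d: "?p = Suc j + d"
      using j less_iff_Suc_add by auto
    then show ?thesis
      using s'(4) inv by (cases d) (auto simp: nd_inv_def)
  qed
  ultimately have "nd_inv C A bs j s'"
    using s' cs inv by (auto simp: nd_inv_def)
  with s'(1) show ?thesis
    by blast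
qed

lemma (in category) for_loop_nd_inv:
  assumes W: "square_witness C A W" and bs: "path C bs" "set bs \<subseteq> A"
  shows "\<lbrakk>j \<le> length bs; nd_inv C A bs j s\<rbrakk> \<Longrightarrow>
    \<exists>s'. for_loop (rev [1..<Suc j]) (nd_round W (length bs)) s = Some s' \<and> nd_inv C A bs 0 s'"
proof (induction j arbitrary: s)
  case (Suc j)
  obtain t where "nd_round W (length bs) (Suc j) s = Some t" "nd_inv C A bs j t"
    using nd_inv_round[OF W bs _ Suc.prems(2)] Suc.prems(1) by auto
  then show ?case
    using Suc.IH[of t] Suc.prems(1) by auto
qed simp


section \<open>Correctness of the algorithm\<close>

lemma (in category) subset_sharp:
  assumes "S \<subseteq> Elt C"
  shows "S \<subseteq> sharp C S"
proof
  fix s assume s: "s \<in> S"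
  let ?e = "ident (tgt s)"
  have tgt: "tgt s \<in> Obj C"
    using s assms tgt_closed by auto
  have "?e \<cdot> ?e = ?e"
    using ident_left[OF ident_closed[OF tgt]] tgt by (simp add: src_ident)
  then have "?e \<in> invertibles C"
    using tgt unfolding invertibles_def
    by (auto simp: ident_closed src_ident tgt_ident intro!: bexI[of _ ?e])
  moreover have "s = s \<cdot> ?e" "tgt s = src ?e"
    using s assms tgt by (auto simp: ident_right src_ident)
  ultimately show "s \<in> sharp C S"
    using s unfolding sharp_def by blast
qed

theorem proposition4p5:
  fixes C :: "('o, 'm) cat"
    and S :: "'m set"
    and W :: "'m \<times> 'm \<Rightarrow> ('m \<times> 'm) option"
    and bs :: "'m list"
    and g :: 'm
  assumes "left_cancellative_category C"
    and "garside_family C S"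
    and "square_witness C (sharp C S) W"
    and "g \<in> Elt C"
    and "set bs \<subseteq> sharp C S"
    and "decomposition C bs g"
  shows "\<exists>as n. run_normal_decomposition W bs = Some (as, n) \<and>
           normal_decomposition C S as g \<and>
           n = length bs * (length bs - 1) div 2"
proof -
  interpret category C
    using assms(1) by (simp add: left_cancellative_category_def)
  have S: "S \<subseteq> sharp C S"
    using assms(2) by (intro subset_sharp) (simp add: garside_family_def)
  have "path C bs"
    using assms(6) by (simp add: decomposition_def)
  then obtain s where s: "for_loop (rev [1..<Suc (length bs)]) (nd_round W (length bs)) (nd_init bs)
      = Some s" and inv: "nd_inv C (sharp C S) bs 0 s"
    using for_loop_nd_inv[OF assms(3) _ assms(5) order.refl nd_inv_init] by blast
  let ?as = "nd_path (length bs) 0 s"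
  have "run_normal_decomposition W bs = Some (?as, calls s)"
    using s by (simp add: run_normal_decomposition_def Let_def nd_path_def)
  moreover have greedy: "greedy C (sharp C S) ?as" and "set ?as \<subseteq> sharp C S"
    using inv by (auto simp: nd_inv_def)
  then have "normal C S ?as"
    using greedy_antimono[OF S] by (simp add: normal_def)
  moreover have "?as = [] \<longleftrightarrow> bs = []"
    by (cases bs) (simp_all add: nd_path_def)
  then have "decomposition C ?as g"
    using assms(6) inv greedy_imp_path[OF greedy] by (auto simp: decomposition_def nd_inv_def)
  moreover have "calls s = length bs * (length bs - 1) div 2"
    using inv by (auto simp: nd_inv_def)
  ultimately show ?thesis
    by (auto simp: normal_decomposition_def)
qed

end
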